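(* Let $q=3^m$ with $m\ge 1$, and let $$C=\{(x,x^2)\mid x\in\mathbb{F}_q,\ x\neq 0\}\cup\{(x,-x^2)\mid x\in\mathbb{F}_q,\ x\neq 0\}\subset \mathbb{F}_q^2.$$ Then $C$, viewed as a subset of $\mathbb{F}_3^{2m}$, is a capset of size $2(q-1)$. If $m$ is odd, then $C$ is a complete capset.
   Context: A capset is a subset of $\mathbb{F}_3^n$ containing no three distinct points on a common affine line over $\mathbb{F}_3$ (equivalently, no three distinct points summing to $0$). A capset is complete if it is not a proper subset of a larger capset. Choosing a basis of $\mathbb{F}_q$ over $\mathbb{F}_3$ identifies $\mathbb{F}_q^2$ with $\mathbb{F}_3^{2m}$ as $\mathbb{F}_3$-vector spaces; the properties above do not depend on the choice of basis. *)

theory Defs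
  imports "HOL-Analysis.Finite_Cartesian_Product" "HOL-Library.Numeral_Type"
    "HOL-Number_Theory.Cong"
begin

text \<open>The field with three elements is the type \<open>3\<close> of integers modulo 3.  The library provides
  it as a commutative ring only, so linear algebra over it goes through the \<open>module\<close> locale,
  whose notions of independence, span and coordinates are those of vector spaces.\<close>

definition F3_affine_line :: "(3, 'n::finite) vec set \<Rightarrow> bool" where
  "F3_affine_line L \<longleftrightarrow> (\<exists>p d. d \<noteq> 0 \<and> L = {p + t *s d | t. True})"

definition capset :: "(3, 'n::finite) vec set \<Rightarrow> bool" where
  "capset A \<longleftrightarrow>
     \<not> (\<exists>L x y z. F3_affine_line L \<and> x \<noteq> y \<and> y \<noteq> z \<and> x \<noteq> z \<and>
          {x, y, z} \<subseteq> A \<and> {x, y, z} \<subseteq> L)"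

definition complete_capset :: "(3, 'n::finite) vec set \<Rightarrow> bool" where
  "complete_capset A \<longleftrightarrow> capset A \<and> \<not> (\<exists>B. capset B \<and> A \<subset> B)"

text \<open>Scalar multiplication by the field with three elements on a field of characteristic 3:
  \<open>Rep_bit1\<close> gives the representative of a residue class in {0, 1, 2}.\<close>

definition F3_scale :: "3 \<Rightarrow> 'a::field \<Rightarrow> 'a" where
  "F3_scale t x = of_int (Rep_bit1 t) * x"

lemma module_F3_scale:
  assumes "CHAR('a::field) = 3"
  shows "module (F3_scale :: 3 \<Rightarrow> 'a \<Rightarrow> 'a)"
proof -
  have r: "(of_int (k mod 3) :: 'a) = of_int k" for k
    using of_int_eq_iff_cong_CHAR[where 'a = 'a] assms by (simp add: cong_def)
  show ?thesis
    by unfold_locales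
      (simp_all add: F3_scale_def bit1.add_def bit1.mult_def bit1.Rep_1
        bit1.Rep_Abs_mod [where 'a = num1, simplified] r algebra_simps)
qed

text \<open>Bases are indexed families, so that coordinate vectors can be formed.\<close>

definition is_F3_basis :: "('m::finite \<Rightarrow> 'a::field) \<Rightarrow> bool" where
  "is_F3_basis b \<longleftrightarrow> inj b \<and> \<not> module.dependent F3_scale (range b) \<and>
     module.span F3_scale (range b) = UNIV"

text \<open>The identification of pairs of field elements with coordinate vectors that is induced by
  a basis: the left summand of the index type holds the coordinates of the first component,
  the right summand those of the second.\<close>

definition F3_coords :: "('m::finite \<Rightarrow> 'a::field) \<Rightarrow> 'a \<times> 'a \<Rightarrow> (3, 'm + 'm) vec" where
  "F3_coords b v = (\<chi> k. case k of
       Inl i \<Rightarrow> module.representation F3_scale (range b) (fst v) (b i)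
     | Inr i \<Rightarrow> module.representation F3_scale (range b) (snd v) (b i))"

definition two_parabolas :: "('a::field \<times> 'a) set" where
  "two_parabolas = {(x, x\<^sup>2) | x. x \<noteq> 0} \<union> {(x, - (x\<^sup>2)) | x. x \<noteq> 0}"

end

theory Submission
  imports Defs "HOL-Number_Theory.Residues"
begin

text \<open>In characteristic 3 three distinct points are collinear over the field with three elements
  if and only if they sum to zero, so the claim is about pairs of field elements.  Three points on
  the same parabola sum to zero only if they coincide, as \<open>x\<^sup>2 + y\<^sup>2 + (x + y)\<^sup>2 = 2 (x - y)\<^sup>2\<close>; and
  \<open>x\<^sup>2 + y\<^sup>2 = (x + y)\<^sup>2\<close> forces \<open>x y = 0\<close>.  For completeness, a point \<open>(a, c)\<close> off the curve with
  \<open>a \<noteq> 0\<close> is completed to a zero sum by one point on each parabola, with abscissae \<open>a \<mp> c / a\<close>.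
  A point \<open>(0, c)\<close> with \<open>c \<noteq> 0\<close> is completed by \<open>(\<plusminus>x, \<epsilon> x\<^sup>2)\<close> with \<open>\<epsilon> x\<^sup>2 = c\<close>, which is solvable because
  \<open>3\<^sup>m \<equiv> 3\<close> modulo 4 for odd \<open>m\<close>; the origin is completed by \<open>(1, 1)\<close> and \<open>(-1, -1)\<close>.\<close>

section \<open>Collinearity over the field with three elements as a zero sum\<close>

lemma F3_cases: "(t::3) = 0 \<or> t = 1 \<or> t = 2"
proof (induct t)
  case (of_int z)
  then have "z = 0 \<or> z = 1 \<or> z = 2" by auto
  then show ?case by auto
qed

lemma vec_F3_triple_zero: "x + x + x = (0 :: (3, 'n::finite) vec)"
proof -
  have "t + t + t = 0" for t :: 3
    using F3_cases[of t] by auto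
  then show ?thesis by (simp add: vec_eq_iff)
qed

text \<open>Distinct points have distinct parameters, hence the parameters 0, 1, 2 in some order,
  with sum 0; the base point enters three times and cancels.\<close>

lemma F3_affine_line_sum_eq_zero:
  fixes x y z :: "(3, 'n::finite) vec"
  assumes "F3_affine_line L" "{x, y, z} \<subseteq> L" "x \<noteq> y" "y \<noteq> z" "x \<noteq> z"
  shows "x + y + z = 0"
proof -
  obtain p d where L: "L = {p + t *s d | t. True}"
    using assms(1) by (auto simp: F3_affine_line_def)
  obtain t u v where xyz: "x = p + t *s d" "y = p + u *s d" "z = p + v *s d"
    using assms(2) L by auto
  have ne: "t \<noteq> u" "u \<noteq> v" "t \<noteq> v"
    using assms(3-5) xyz by auto
  have "t + u + v = 0"
    using F3_cases[of t] F3_cases[of u] F3_cases[of v] ne by auto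
  moreover have "x + y + z = (p + p + p) + (t + u + v) *s d"
    by (simp add: xyz vec_eq_iff algebra_simps)
  moreover have "0 *s d = 0" by (simp add: vec_eq_iff)
  ultimately show ?thesis
    by (simp only: vec_F3_triple_zero add_0)
qed

lemma F3_affine_line_through:
  fixes x y z :: "(3, 'n::finite) vec"
  assumes "x \<noteq> y" "x + y + z = 0"
  shows "\<exists>L. F3_affine_line L \<and> {x, y, z} \<subseteq> L"
proof -
  define L where "L = {x + t *s (y - x) | t. True}"
  have "F3_affine_line L"
    unfolding F3_affine_line_def L_def using assms(1)
    by (intro exI[of _ x] exI[of _ "y - x"]) simp
  moreover have "x \<in> L" "y \<in> L"
    by (auto simp: L_def vec_eq_iff intro: exI[of _ 0] exI[of _ 1])
  moreover have "z = x + 2 *s (y - x)"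
  proof -
    have "z = - x - y" using assms(2) by (simp add: algebra_simps eq_neg_iff_add_eq_0)
    \<comment> \<open>Adding \<open>3 y = 0\<close> brings the point into the form of parameter 2 on
      the line from \<open>x\<close> to \<open>y\<close>.\<close>
    also have "\<dots> = - x - y + (y + y + y)" by (simp only: vec_F3_triple_zero) simp
    also have "\<dots> = x + 2 *s (y - x)" by (simp add: vec_eq_iff algebra_simps)
    finally show ?thesis .
  qed
  then have "z \<in> L" by (auto simp: L_def)
  ultimately show ?thesis by blast
qed

text \<open>This additive form can be carried along any injective additive map, in particular along
  the coordinate map.\<close>

lemma capset_iff:
  "capset A \<longleftrightarrow> (\<forall>x\<in>A. \<forall>y\<in>A. \<forall>z\<in>A. x \<noteq> y \<longrightarrow> y \<noteq> z \<longrightarrow> x \<noteq> z \<longrightarrow> x + y + z \<noteq> 0)"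
proof
  show "\<forall>x\<in>A. \<forall>y\<in>A. \<forall>z\<in>A. x \<noteq> y \<longrightarrow> y \<noteq> z \<longrightarrow> x \<noteq> z \<longrightarrow> x + y + z \<noteq> 0" if "capset A"
  proof (intro ballI impI notI)
    fix x y z assume "x \<in> A" "y \<in> A" "z \<in> A" "x \<noteq> y" "y \<noteq> z" "x \<noteq> z" "x + y + z = 0"
    with F3_affine_line_through[of x y z] that show False
      unfolding capset_def by (metis empty_subsetI insert_subset)
  qed
  show "capset A"
    if "\<forall>x\<in>A. \<forall>y\<in>A. \<forall>z\<in>A. x \<noteq> y \<longrightarrow> y \<noteq> z \<longrightarrow> x \<noteq> z \<longrightarrow> x + y + z \<noteq> 0"
    unfolding capset_def using F3_affine_line_sum_eq_zero that by (metis insert_subset)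
qed

section \<open>Characteristic and squares in finite fields\<close>

lemma CHAR_eq_3:
  assumes "CARD('a::{field,finite}) = 3 ^ m"
  shows "CHAR('a) = 3"
proof -
  have "prime CHAR('a)"
    by (rule prime_CHAR_semidom) (simp add: finite_imp_CHAR_pos)
  moreover have "CHAR('a) dvd 3 ^ m"
    using CHAR_dvd_CARD[where 'a = 'a] assms by simp
  ultimately show ?thesis
    by (auto dest: prime_dvd_power intro: primes_dvd_imp_eq)
qed

text \<open>The library has this for the class \<open>finite_field\<close>, which a type variable of sort
  \<open>{field, finite}\<close> does not belong to.\<close>

lemma power_card_eq_self:
  fixes c :: "'a::{field,finite}"
  shows "c ^ CARD('a) = c"
proof (cases "c = 0")
  case False
  let ?U = "UNIV - {0 :: 'a}"
  have "bij_betw ((*) c) ?U ?U"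
    by (rule bij_betw_byWitness[where f' = "\<lambda>x. x / c"]) (use False in auto)
  \<comment> \<open>Multiplication by \<open>c\<close> permutes the nonzero elements, so it fixes
    their product, which is nonzero and cancels.\<close>
  then have "\<Prod>?U = (\<Prod>x\<in>?U. c * x)"
    by (rule prod.reindex_bij_betw [symmetric])
  also have "\<dots> = c ^ (CARD('a) - 1) * \<Prod>?U"
    by (simp add: prod.distrib)
  finally have "c ^ (CARD('a) - 1) = 1" by simp
  then show ?thesis
    by (metis finite_UNIV_card_ge_0 finite power_minus_mult mult_1)
qed simp

text \<open>For \<open>c \<noteq> 0\<close> and field order \<open>q = 4 k + 3\<close>, Euler's
  criterion makes \<open>e = c ^ ((q - 1) / 2)\<close> equal to 1 or -1, and the power of
  \<open>c\<close> with exponent \<open>(q + 1) / 4 = k + 1\<close> squares to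
  \<open>e * c\<close>.\<close>

lemma square_or_neg_square:
  fixes c :: "'a::{field,finite}"
  assumes "CARD('a) mod 4 = 3"
  shows "\<exists>x. x\<^sup>2 = c \<or> - (x\<^sup>2) = c"
proof (cases "c = 0")
  case True
  then show ?thesis by (intro exI[of _ 0]) simp
next
  case False
  obtain k where k: "CARD('a) = 4 * k + 3"
    using assms by (metis mult_div_mod_eq)
  define e where "e = c ^ (2 * k + 1)"
  have "c ^ (4 * k + 3) = c"
    using power_card_eq_self[of c] k by simp
  also have "c ^ (4 * k + 3) = c * e\<^sup>2"
  proof -
    have "4 * k + 3 = 1 + (2 * k + 1) * 2" by simp
    then show ?thesis by (simp only: e_def power_add power_mult power_one_right)
  qed
  finally have "e\<^sup>2 = 1" using False by simp
  then have e: "e = 1 \<or> e = -1" by (simp add: power2_eq_1_iff)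
  have sq: "(c ^ (k + 1))\<^sup>2 = e * c"
    by (simp add: e_def power2_eq_square mult_2 power_add [symmetric])
  show ?thesis
    using e
  proof
    assume "e = 1"
    with sq show ?thesis by (metis mult_1)
  next
    assume "e = -1"
    with sq have "- ((c ^ (k + 1))\<^sup>2) = c" by simp
    then show ?thesis by blast
  qed
qed

lemma power_3_mod_4: "odd m \<Longrightarrow> 3 ^ m mod 4 = (3::nat)"
proof (elim oddE)
  fix k assume "m = 2 * k + 1"
  then have "(3::nat) ^ m = 9 ^ k * 3"
    by (simp add: power_mult)
  moreover have "(9::nat) ^ k mod 4 = 1"
    by (induction k) (simp_all add: mod_mult_right_eq [of 9, symmetric])
  then have "(9::nat) ^ k * 3 mod 4 = 3"
    by (simp add: mod_mult_left_eq [of "9 ^ k", symmetric])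
  ultimately show "3 ^ m mod 4 = (3::nat)" by simp
qed

section \<open>Zero sums on the two parabolas in characteristic 3\<close>

lemma three_eq_0_if_CHAR_3: "CHAR('a::ring_1) = 3 \<Longrightarrow> (3::'a) = 0"
  using of_nat_CHAR[where 'a = 'a] by simp

text \<open>This separates \<open>x\<close> from \<open>- x\<close> and the two parabolas from each
  other.\<close>

lemma CHAR_3_eq_neg_self:
  fixes y :: "'a::field"
  assumes "CHAR('a) = 3" and y: "y = - y"
  shows "y = 0"
proof -
  have "y + y = 0" using y by (simp only: eq_neg_iff_add_eq_0)
  then have "y = y + y + y" by (simp only: add_0)
  also have "\<dots> = 3 * y" by simp
  finally show ?thesis using three_eq_0_if_CHAR_3[OF assms(1)] by simp
qed

text \<open>The sign \<open>s\<close> covers both parabolas by one formula, so that cases on points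
  become cases on signs.\<close>

lemma two_parabolas_iff:
  "p \<in> two_parabolas \<longleftrightarrow> (\<exists>x s. p = (x, s * x\<^sup>2) \<and> x \<noteq> 0 \<and> (s = 1 \<or> s = -1))"
proof
  show "\<exists>x s. p = (x, s * x\<^sup>2) \<and> x \<noteq> 0 \<and> (s = 1 \<or> s = -1)" if "p \<in> two_parabolas"
    using that unfolding two_parabolas_def
    by (elim UnE CollectE exE conjE) (metis mult_1, metis mult_minus1)
qed (auto simp: two_parabolas_def)

lemma two_parabolas_sum_ne_zero:
  fixes p q r :: "'a::field \<times> 'a"
  assumes char: "CHAR('a) = 3"
    and mem: "p \<in> two_parabolas" "q \<in> two_parabolas" "r \<in> two_parabolas"
    and ne: "p \<noteq> q" "q \<noteq> r" "p \<noteq> r"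
  shows "p + q + r \<noteq> 0"
proof
  assume "p + q + r = 0"
  have three: "(3::'a) = 0" using char by (rule three_eq_0_if_CHAR_3)
  have two: "(2::'a) \<noteq> 0" using CHAR_3_eq_neg_self[OF char, of 1] by auto
  obtain x s where p: "p = (x, s * x\<^sup>2)" "x \<noteq> 0" "s = 1 \<or> s = -1"
    using mem(1) by (auto simp: two_parabolas_iff)
  obtain y t where q: "q = (y, t * y\<^sup>2)" "y \<noteq> 0" "t = 1 \<or> t = -1"
    using mem(2) by (auto simp: two_parabolas_iff)
  obtain z u where r: "r = (z, u * z\<^sup>2)" "z \<noteq> 0" "u = 1 \<or> u = -1"
    using mem(3) by (auto simp: two_parabolas_iff)
  have z: "x + y + z = 0" and eq: "s * x\<^sup>2 + t * y\<^sup>2 + u * z\<^sup>2 = 0"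
    using \<open>p + q + r = 0\<close> p q r by (simp_all add: zero_prod_def)
  have same: "a = b" if "a + b + c = 0" "a\<^sup>2 + b\<^sup>2 + c\<^sup>2 = 0" for a b c :: 'a
  proof -
    have c: "c = - (a + b)" using that(1) by (simp only: eq_neg_iff_add_eq_0 add.commute)
    have "2 * (a\<^sup>2 + a * b + b\<^sup>2) = a\<^sup>2 + b\<^sup>2 + c\<^sup>2"
      unfolding c by (simp add: power2_eq_square algebra_simps)
    then have "2 * (a\<^sup>2 + a * b + b\<^sup>2) = 0" using that(2) by simp
    then have "a\<^sup>2 + a * b + b\<^sup>2 = 0" using two by (metis mult_eq_0_iff)
    \<comment> \<open>In characteristic 3 the quadratic form is a perfect square.\<close>
    moreover have "(a - b)\<^sup>2 = a\<^sup>2 + a * b + b\<^sup>2 - 3 * (a * b)"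
      by (simp add: power2_eq_square algebra_simps)
    ultimately show ?thesis using three by simp
  qed
  have mixed: False if "a + b + c = 0" "a\<^sup>2 + b\<^sup>2 = c\<^sup>2" "a \<noteq> 0" "b \<noteq> 0" for a b c :: 'a
  proof -
    have c: "c = - (a + b)" using that(1) by (simp only: eq_neg_iff_add_eq_0 add.commute)
    have "2 * (a * b) = c\<^sup>2 - (a\<^sup>2 + b\<^sup>2)"
      unfolding c by (simp add: power2_eq_square algebra_simps)
    then have "2 * (a * b) = 0" using that(2) by simp
    with two that show False by simp
  qed
  \<comment> \<open>Among three signs either all agree or exactly one differs; the differing one
    belongs to \<open>z\<close>, \<open>y\<close>, \<open>x\<close> in turn.\<close>
  consider "s = t" "t = u" | "s = t" "u = - s" | "s = u" "t = - s" | "t = u" "s = - t"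
    using p(3) q(3) r(3) by fastforce
  then show False
  proof cases
    case 1
    have "s * (x\<^sup>2 + y\<^sup>2 + z\<^sup>2) = 0" using eq 1 by (simp add: algebra_simps)
    then have "x\<^sup>2 + y\<^sup>2 + z\<^sup>2 = 0" using p(3) by auto
    with same z have "x = y" by blast
    with p q 1 ne show False by simp
  next
    case 2
    have "s * (x\<^sup>2 + y\<^sup>2 - z\<^sup>2) = 0" using eq 2 by (simp add: algebra_simps)
    then have "x\<^sup>2 + y\<^sup>2 = z\<^sup>2" using p(3) by auto
    then show False using mixed z p q by blast
  next
    case 3
    have "s * (x\<^sup>2 + z\<^sup>2 - y\<^sup>2) = 0" using eq 3 by (simp add: algebra_simps)
    then have "x\<^sup>2 + z\<^sup>2 = y\<^sup>2" using p(3) by auto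
    then show False using mixed[of x z y] z p r by (simp add: algebra_simps)
  next
    case 4
    have "t * (y\<^sup>2 + z\<^sup>2 - x\<^sup>2) = 0" using eq 4 by (simp add: algebra_simps)
    then have "y\<^sup>2 + z\<^sup>2 = x\<^sup>2" using q(3) by auto
    then show False using mixed[of y z x] z q r by (simp add: algebra_simps)
  qed
qed

text \<open>The parabolas could meet only where \<open>x\<^sup>2 = - (x\<^sup>2)\<close>, that is,
  at the excluded origin.\<close>

lemma card_two_parabolas:
  assumes "CHAR('a::{field,finite}) = 3"
  shows "card (two_parabolas :: ('a \<times> 'a) set) = 2 * (CARD('a) - 1)"
proof -
  let ?f = "\<lambda>x::'a. (x, x\<^sup>2)" and ?g = "\<lambda>x::'a. (x, - (x\<^sup>2))"
  have eq: "two_parabolas = ?f ` (UNIV - {0}) \<union> ?g ` (UNIV - {0})"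
    by (auto simp: two_parabolas_def)
  have "x\<^sup>2 \<noteq> - (x\<^sup>2)" if "x \<noteq> 0" for x :: 'a
    using CHAR_3_eq_neg_self[OF assms, of "x\<^sup>2"] that by (metis zero_eq_power2)
  then have "?f ` (UNIV - {0}) \<inter> ?g ` (UNIV - {0}) = {}" by blast
  then have "card (two_parabolas :: ('a \<times> 'a) set)
      = card (?f ` (UNIV - {0})) + card (?g ` (UNIV - {0}))"
    unfolding eq by (intro card_Un_disjoint) auto
  also have "card (?f ` (UNIV - {0})) = CARD('a) - 1"
    by (subst card_image) (auto simp: inj_on_def)
  also have "card (?g ` (UNIV - {0})) = CARD('a) - 1"
    by (subst card_image) (auto simp: inj_on_def)
  finally show ?thesis by simp
qed

section \<open>Completing points off the curve to zero sums\<close>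

lemma two_parabolas_complete:
  fixes v :: "'a::{field,finite} \<times> 'a"
  assumes char: "CHAR('a) = 3" and card: "CARD('a) mod 4 = 3" and v: "v \<notin> two_parabolas"
  shows "\<exists>p\<in>two_parabolas. \<exists>r\<in>two_parabolas. p \<noteq> r \<and> p + r + v = 0"
proof -
  obtain a c where ac: "v = (a, c)" by (cases v)
  have three: "(3::'a) = 0" using char by (rule three_eq_0_if_CHAR_3)
  show ?thesis
  proof (cases "a = 0")
    case False
    have off: "c \<noteq> a\<^sup>2" "c \<noteq> - (a\<^sup>2)" using v ac False by (auto simp: two_parabolas_def)
    define d where "d = c / a"
    have c: "c = d * a" using False by (simp add: d_def)
    \<comment> \<open>The requirements \<open>x + y = - a\<close> and
      \<open>x\<^sup>2 - y\<^sup>2 = - c\<close> give \<open>x - y = c / a = d\<close>; since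
      \<open>2 = -1\<close>, these are the solutions.\<close>
    define x y where "x = a - d" and "y = a + d"
    \<comment> \<open>A vanishing abscissa would put \<open>(a, c)\<close> on one of the
      parabolas.\<close>
    have "x \<noteq> 0"
    proof
      assume "x = 0"
      then have "d = a" by (simp add: x_def)
      with c off(1) show False by (simp add: power2_eq_square)
    qed
    have "y \<noteq> 0"
    proof
      assume "y = 0"
      then have "d = - a" by (simp add: y_def add_eq_0_iff)
      with c off(2) show False by (simp add: power2_eq_square)
    qed
    have "(x, x\<^sup>2) \<in> two_parabolas" "(y, - (y\<^sup>2)) \<in> two_parabolas"
      using \<open>x \<noteq> 0\<close> \<open>y \<noteq> 0\<close> by (auto simp: two_parabolas_def)
    moreover have "(x, x\<^sup>2) \<noteq> (y, - (y\<^sup>2))"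
      using CHAR_3_eq_neg_self[OF char, of "x\<^sup>2"] \<open>x \<noteq> 0\<close> by (metis Pair_inject zero_eq_power2)
    moreover have "x + y + a = 0" "x\<^sup>2 + - (y\<^sup>2) + c = 0"
    proof -
      have "x + y + a = 3 * a" by (simp add: x_def y_def)
      then show "x + y + a = 0" using three by simp
      have "x\<^sup>2 + - (y\<^sup>2) + c = - 3 * (d * a)"
        unfolding x_def y_def c by (simp add: power2_eq_square algebra_simps)
      then show "x\<^sup>2 + - (y\<^sup>2) + c = 0" using three by simp
    qed
    then have "(x, x\<^sup>2) + (y, - (y\<^sup>2)) + v = 0"
      by (simp add: ac zero_prod_def)
    ultimately show ?thesis by blast
  next
    case True
    have "\<exists>x s::'a. x \<noteq> 0 \<and> (s = 1 \<or> s = -1) \<and> s * x\<^sup>2 = c" if "c \<noteq> 0"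
    proof -
      obtain x where "x\<^sup>2 = c \<or> - (x\<^sup>2) = c"
        using square_or_neg_square[OF card] by blast
      moreover from this that have "x \<noteq> 0" by auto
      ultimately show ?thesis
        by (metis mult_1 mult_minus_left)
    qed
    \<comment> \<open>The points will have abscissae \<open>x\<close> and \<open>- x\<close>, which
      cancel. Their signs are equal for \<open>c \<noteq> 0\<close>, as \<open>3 c = 0\<close>, and
      opposite for the origin.\<close>
    then obtain x s t :: 'a where x: "x \<noteq> 0" "s = 1 \<or> s = -1" "t = 1 \<or> t = -1"
      "s * x\<^sup>2 + t * x\<^sup>2 + c = 0"
    proof (cases "c = 0")
      case True
      show ?thesis by (rule that[of 1 1 "-1"]) (use True in auto)
    next
      case False
      obtain x s :: 'a where x: "x \<noteq> 0" "s = 1 \<or> s = -1" and c: "s * x\<^sup>2 = c"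
        using \<open>c \<noteq> 0 \<Longrightarrow> _\<close> False by blast
      have "c + c + c = 3 * c" by simp
      then have "s * x\<^sup>2 + s * x\<^sup>2 + c = 0" unfolding c three by simp
      then show ?thesis using x by (intro that[of x s s]) auto
    qed
    have "(x, s * x\<^sup>2) \<in> two_parabolas" "(- x, t * x\<^sup>2) \<in> two_parabolas"
      using x by (auto simp: two_parabolas_def)
    moreover have "(x, s * x\<^sup>2) \<noteq> (- x, t * x\<^sup>2)"
      using CHAR_3_eq_neg_self[OF char, of x] x(1) by auto
    moreover have "(x, s * x\<^sup>2) + (- x, t * x\<^sup>2) + v = 0"
      using x(4) True by (simp add: ac zero_prod_def)
    ultimately show ?thesis by blast
  qed
qed

section \<open>The coordinate map as an additive bijection\<close>

lemma F3_coords_add: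
  fixes b :: "'m::finite \<Rightarrow> 'a::field"
  assumes char: "CHAR('a) = 3" and b: "is_F3_basis b"
  shows "F3_coords b (u + v) = F3_coords b u + F3_coords b v"
proof -
  interpret Modules.module "F3_scale :: 3 \<Rightarrow> 'a \<Rightarrow> 'a"
    using char by (rule module_F3_scale)
  have "representation (range b) (x + y) = (\<lambda>i. representation (range b) x i + representation (range b) y i)"
    for x y
    using b by (intro representation_add) (auto simp: is_F3_basis_def)
  then show ?thesis
    by (simp add: F3_coords_def vec_eq_iff split: sum.split)
qed

lemma inj_F3_coords:
  fixes b :: "'m::finite \<Rightarrow> 'a::field"
  assumes char: "CHAR('a) = 3" and b: "is_F3_basis b"
  shows "inj (F3_coords b)"
proof (rule injI)
  interpret Modules.module "F3_scale :: 3 \<Rightarrow> 'a \<Rightarrow> 'a"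
    using char by (rule module_F3_scale)
  have determined: "x = y"
    if "\<And>i. representation (range b) x (b i) = representation (range b) y (b i)" for x y
  proof -
    have sum: "(\<Sum>c\<in>range b. F3_scale (representation (range b) z c) c) = z" for z
      using b by (intro sum_representation_eq) (auto simp: is_F3_basis_def)
    have "x = (\<Sum>c\<in>range b. F3_scale (representation (range b) x c) c)" by (simp only: sum)
    also have "\<dots> = (\<Sum>c\<in>range b. F3_scale (representation (range b) y c) c)"
      using that by (intro sum.cong) auto
    finally show ?thesis by (simp only: sum)
  qed
  fix u v assume eq: "F3_coords b u = F3_coords b v"
  have "fst u = fst v"
    by (rule determined) (use spec [OF eq [unfolded vec_eq_iff], of "Inl _"] in \<open>simp add: F3_coords_def\<close>)
  moreover have "snd u = snd v"
    by (rule determined) (use spec [OF eq [unfolded vec_eq_iff], of "Inr _"] in \<open>simp add: F3_coords_def\<close>)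
  ultimately show "u = v" by (rule prod_eqI)
qed

text \<open>Both sides have \<open>9 ^ CARD('m)\<close> elements, so injectivity suffices.\<close>

lemma surj_F3_coords:
  fixes b :: "'m::finite \<Rightarrow> 'a::{field,finite}"
  assumes "CARD('a) = 3 ^ CARD('m)" and b: "is_F3_basis b"
  shows "surj (F3_coords b)"
proof -
  have "card (range (F3_coords b)) = CARD('a \<times> 'a)"
    using inj_F3_coords[OF CHAR_eq_3[OF assms(1)] b] by (rule card_image)
  also have "\<dots> = CARD((3, 'm + 'm) vec)"
    using assms(1) by (simp add: power_add)
  finally show ?thesis
    by (intro card_subset_eq) auto
qed

section \<open>Transfer from pairs of field elements to coordinate vectors\<close>

theorem theorem2p1:
  fixes m :: nat and b :: "'m::finite \<Rightarrow> 'a::{field,finite}"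
  assumes "m \<ge> 1"
    and "CARD('a) = 3 ^ m"
    and "CARD('m) = m"
    and "is_F3_basis b"
  shows "capset (F3_coords b ` two_parabolas) \<and>
         card (F3_coords b ` two_parabolas) = 2 * (CARD('a) - 1) \<and>
         (odd m \<longrightarrow> complete_capset (F3_coords b ` two_parabolas))"
proof -
  let ?f = "F3_coords b"
  let ?C = "?f ` two_parabolas"
  have char: "CHAR('a) = 3" using assms(2) by (rule CHAR_eq_3)
  have inj: "inj ?f" using char assms(4) by (rule inj_F3_coords)
  have surj: "surj ?f" using assms(2-4) by (intro surj_F3_coords) simp_all
  have add: "?f (u + v) = ?f u + ?f v" for u v
    using char assms(4) by (rule F3_coords_add)
  have zero: "?f 0 = 0" using add[of 0 0] by simp
  \<comment> \<open>An injective additive map preserves and reflects zero sums, so the statements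
    about pairs carry over.\<close>
  have sum_zero: "?f p + ?f q + ?f r = 0 \<longleftrightarrow> p + q + r = 0" for p q r
    using inj zero by (metis add injD)
  have cap: "capset ?C"
    unfolding capset_iff ball_simps sum_zero
    using two_parabolas_sum_ne_zero[OF char] by metis
  moreover have "card ?C = 2 * (CARD('a) - 1)"
    using inj by (simp add: card_image inj_on_subset card_two_parabolas[OF char])
  moreover have "complete_capset ?C" if "odd m"
    unfolding complete_capset_def
  proof (intro conjI notI cap)
    assume "\<exists>B. capset B \<and> ?C \<subset> B"
    then obtain B w where B: "capset B" "?C \<subseteq> B" and w: "w \<in> B" "w \<notin> ?C" by blast
    obtain v where v: "w = ?f v" using surj by (metis surjD)
    then have "v \<notin> two_parabolas" using w by blast
    moreover have "CARD('a) mod 4 = 3" using assms(2) power_3_mod_4[OF that] by simp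
    ultimately obtain p r where pr: "p \<in> two_parabolas" "r \<in> two_parabolas" "p \<noteq> r" "p + r + v = 0"
      using two_parabolas_complete[OF char] by blast
    have "?f p \<noteq> ?f r" using inj pr(3) by (simp add: inj_eq)
    \<comment> \<open>Distinctness from \<open>w\<close> comes from \<open>w\<close> lying outside
      the image of the curve.\<close>
    moreover have "?f p \<noteq> w" "?f r \<noteq> w" using w(2) pr by auto
    moreover have "?f p + ?f r + w = 0" unfolding v using pr(4) by (simp add: sum_zero)
    moreover have "?f p \<in> B" "?f r \<in> B" using B(2) pr by auto
    ultimately show False using B(1) w(1) unfolding capset_iff by blast
  qed
  ultimately show ?thesis by blast
qed

end
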